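(* Suppose a loan has been confirmed extinguished at time $\sigma$ ($D_{\sigma^+}=0$) and no new borrowing, delay compensation, or redemption guarantee is attached to the extinguished loan after $\sigma$. Let $\Delta_f=\tau_f-\sigma$ and $\Delta_r=\tau_r-\tau_f$. Then $$\frac{\partial L^{\mathrm{credit}}_{\mathrm{loan}}}{\partial\Delta_f}=0,\qquad \frac{\partial L^{\mathrm{credit}}_{\mathrm{loan}}}{\partial\Delta_r}=0 .$$ (The user may still bear opportunity cost, custody risk, legal uncertainty, and platform-access risk during both intervals.)
   Context: A binary-event outcome token position is financed by a loan with outstanding debt $D_t$. $\sigma$ is the confirmed time at which settled sale proceeds have been applied to the loan and debt is zero. $\tau_f\ge\sigma$ is the time at which the event's payout vector becomes final (after any delay, challenge or dispute), and $\tau_r\ge\tau_f$ is the time at which redemption of the residual outcome tokens into cash is confirmed. $\Delta_f$ is the interval from debt extinction to final payout and $\Delta_r$ is the redemption latency. $L^{\mathrm{credit}}_{\mathrm{loan}}$ is the lender's credit-principal loss through this loan, i.e. the loss on the outstanding receivable of the loan, regarded as a function of $\Delta_f$ and $\Delta_r$. Redemption of outcome tokens is paid from collateral separate from the loan receivable. *)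

theory Defs
  imports "HOL-Analysis.Analysis"
begin

text \<open>
  One realised history of a loan against an outcome-token position.  Apart from \<open>debt\<close>,
  \<open>interest_rate\<close> and \<open>late_recovery\<close>, the fields are running totals: their value at
  \<open>t\<close> is the amount booked up to time \<open>t\<close>.

  \<open>debt t\<close> is the outstanding receivable \<open>D\<^sub>t\<close>.  It is the amount legally owed, so it
  falls only through repayment and is not reduced by accounting write-offs.  Amounts paid out under
  a delay-compensation or redemption-guarantee arrangement attached to the loan are advanced on the
  loan account and so enlarge the receivable, just as new borrowing does.
  \<open>redeemed\<close> is the cash paid on redemption of outcome tokens and
  \<open>redeemed_from_collateral\<close> the part of it met by the collateral backing the tokens.
  \<open>late_recovery\<close> is the amount the lender still collects, once redemption has been confirmed,
  on whatever is outstanding then.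
\<close>

record loan_history =
  debt :: "real \<Rightarrow> real"
  interest_rate :: "real \<Rightarrow> real"
  borrowed :: "real \<Rightarrow> real"
  delay_compensation :: "real \<Rightarrow> real"
  redemption_guarantee :: "real \<Rightarrow> real"
  redeemed :: "real \<Rightarrow> real"
  redeemed_from_collateral :: "real \<Rightarrow> real"
  repaid :: "real \<Rightarrow> real"
  late_recovery :: real

text \<open>
  Redemption cash not met by the token collateral would have to be charged to the loan account.
\<close>

definition redemption_charged :: "loan_history \<Rightarrow> real \<Rightarrow> real" where
  "redemption_charged H t = redeemed H t - redeemed_from_collateral H t"

definition debits :: "loan_history \<Rightarrow> real \<Rightarrow> real" where
  "debits H t = borrowed H t + delay_compensation H t + redemption_guarantee H t
                + redemption_charged H t"

text \<open>
  The last clause is the balance equation of the loan account: the change in debt is the interest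
  accrued on the outstanding debt, plus debits, minus repayments.  As all running totals are
  monotone, \<open>debt\<close> has a right limit everywhere.
\<close>

definition loan_account :: "loan_history \<Rightarrow> bool" where
  "loan_account H \<longleftrightarrow>
     (\<forall>t. 0 \<le> debt H t) \<and> (\<forall>t. 0 \<le> interest_rate H t) \<and>
     (\<forall>a b. bounded (interest_rate H ` {a..b})) \<and>
     mono (borrowed H) \<and> mono (delay_compensation H) \<and> mono (redemption_guarantee H) \<and>
     mono (redemption_charged H) \<and> mono (repaid H) \<and> 0 \<le> late_recovery H \<and>
     (\<forall>s t. s \<le> t \<longrightarrow>
        ((\<lambda>u. interest_rate H u * debt H u) has_integral
           (debt H t - debt H s - (debits H t - debits H s) + (repaid H t - repaid H s))) {s..t})"

text \<open>\<open>D\<^bsub>\<sigma>+\<^esub> = 0\<close>\<close>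

definition extinguished_at :: "loan_history \<Rightarrow> real \<Rightarrow> bool" where
  "extinguished_at H \<sigma> \<longleftrightarrow> (debt H \<longlongrightarrow> 0) (at_right \<sigma>)"

definition redemption_paid_from_separate_collateral :: "loan_history \<Rightarrow> bool" where
  "redemption_paid_from_separate_collateral H \<longleftrightarrow>
     (\<forall>t. redeemed H t = redeemed_from_collateral H t)"

text \<open>
  The lender's loss on the receivable left outstanding once redemption is confirmed at
  \<open>\<tau>r\<close>.  The right limit counts everything booked at \<open>\<tau>r\<close> itself; in particular, for
  \<open>\<tau>r = \<sigma>\<close> the relevant balance is \<open>D\<^bsub>\<sigma>+\<^esub>\<close>.
\<close>

definition credit_loss :: "loan_history \<Rightarrow> real \<Rightarrow> real" where
  "credit_loss H \<tau>r = max 0 (Lim (at_right \<tau>r) (debt H) - late_recovery H)"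

text \<open>
  The history may depend on when the payout becomes final and when redemption is confirmed, so
  a loan is given by a family \<open>\<L>\<close> of histories indexed by \<open>\<tau>f\<close> and \<open>\<tau>r\<close>.
  The loss as a function of the two delays is obtained by setting
  \<open>\<tau>f = \<sigma> + \<Delta>f\<close> and \<open>\<tau>r = \<tau>f + \<Delta>r\<close>.
\<close>

definition credit_loss_of_delays ::
    "(real \<Rightarrow> real \<Rightarrow> loan_history) \<Rightarrow> real \<Rightarrow> real \<Rightarrow> real \<Rightarrow> real" where
  "credit_loss_of_delays \<L> \<sigma> \<Delta>f \<Delta>r =
     credit_loss (\<L> (\<sigma> + \<Delta>f) (\<sigma> + \<Delta>f + \<Delta>r)) (\<sigma> + \<Delta>f + \<Delta>r)"

end

theory Submission
  imports Defs
begin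

text \<open>
  After \<open>\<sigma>\<close> nothing is debited to the account, so by Gronwall's inequality the debt at \<open>t\<close>
  is at most a constant multiple of the debt at any earlier \<open>s > \<sigma>\<close>.  Letting \<open>s\<close> tend
  to \<open>\<sigma>\<close> shows that no debt ever reappears; hence the credit loss is identically zero.
\<close>

text \<open>Since \<open>f\<close> may jump, the argument does not differentiate it. In the supremum
  norm weighted by a decaying exponential, integrating \<open>M * f\<close> is a contraction with
  factor 1/2; the price is the factor 2 and the doubled rate in the bound.\<close>

lemma gronwall_integral_bound:
  fixes f g I :: "real \<Rightarrow> real"
  assumes "0 < M" "0 \<le> c"
    and nonneg: "\<And>u. u \<in> {a..b} \<Longrightarrow> 0 \<le> f u"
    and bdd: "bdd_above (f ` {a..b})"
    and int: "\<And>u. u \<in> {a..b} \<Longrightarrow> (g has_integral I u) {a..u}"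
    and g: "\<And>u. u \<in> {a..b} \<Longrightarrow> g u \<le> M * f u"
    and f: "\<And>u. u \<in> {a..b} \<Longrightarrow> f u \<le> c + I u"
    and t: "t \<in> {a..b}"
  shows "f t \<le> 2 * c * exp (2 * M * (t - a))"
proof -
  \<comment> \<open>With rate \<open>2 * M\<close> instead of \<open>M\<close> the integral contributes at most \<open>S / 2\<close>,
    which is absorbed on the left.\<close>
  define w where "w u = exp (2 * M * (u - a))" for u
  define S where "S = (SUP u\<in>{a..b}. f u / w u)"
  have w_pos: "0 < w u" for u by (simp add: w_def)
  have w_ge1: "1 \<le> w u" if "a \<le> u" for u
    using that \<open>0 < M\<close> by (simp add: w_def)
  obtain B where B: "\<And>u. u \<in> {a..b} \<Longrightarrow> f u \<le> B"
    using bdd unfolding bdd_above_def by blast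
  \<comment> \<open>Finiteness makes \<open>S\<close> a genuine supremum. Dividing by
    \<open>w u\<close>, which is at least 1, preserves the bound \<open>B\<close> because
    \<open>f\<close> is nonnegative.\<close>
  have "f u / w u \<le> B" if "u \<in> {a..b}" for u
  proof -
    have "f u / w u \<le> f u"
      using nonneg[OF that] w_ge1[of u] that
      by (simp add: field_simps mult_le_cancel_left1)
    then show ?thesis using B[OF that] by linarith
  qed
  then have "bdd_above ((\<lambda>u. f u / w u) ` {a..b})" by (intro bdd_aboveI2)
  then have upper: "f u / w u \<le> S" if "u \<in> {a..b}" for u
    unfolding S_def using that by (intro cSUP_upper)
  have S_nonneg: "0 \<le> S"
    using upper[OF t] nonneg[OF t] w_pos[of t] by (meson divide_nonneg_pos order_trans)
  have "f u / w u \<le> c + S / 2" if u: "u \<in> {a..b}" for u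
  proof -
    \<comment> \<open>The derivative of \<open>w\<close> is \<open>2 * M * w\<close>, so
      \<open>S / 2 * w\<close> is an antiderivative of the majorant
      \<open>M * S * w\<close>.\<close>
    have "((\<lambda>v. M * S * w v) has_integral (S / 2 * w u - S / 2 * w a)) {a..u}"
      using u unfolding w_def
      by (intro fundamental_theorem_of_calculus)
        (auto intro!: derivative_eq_intros simp flip: has_real_derivative_iff_has_vector_derivative)
    moreover have "g v \<le> M * S * w v" if v: "v \<in> {a..u}" for v
    proof -
      have "v \<in> {a..b}" using v u by auto
      then have "f v \<le> S * w v"
        using upper[of v] w_pos[of v] by (simp add: pos_divide_le_eq)
      then have "M * f v \<le> M * (S * w v)" using \<open>0 < M\<close> by simp
      then show ?thesis using g[OF \<open>v \<in> {a..b}\<close>] by (simp add: mult.assoc)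
    qed
    ultimately have "I u \<le> S / 2 * w u - S / 2 * w a"
      using int[OF u] by (auto intro: has_integral_le)
    then have "f u \<le> c + S / 2 * w u"
      using f[OF u] S_nonneg w_pos[of a] by (smt (verit) divide_nonneg_nonneg mult_nonneg_nonneg)
    also have "\<dots> \<le> (c + S / 2) * w u"
      using \<open>0 \<le> c\<close> w_ge1[of u] u by (simp add: distrib_right mult_le_cancel_left1)
    finally show ?thesis using w_pos[of u] by (simp add: pos_divide_le_eq)
  qed
  \<comment> \<open>The estimate is uniform in \<open>u\<close>, so it passes to the supremum and
    forces \<open>S \<le> 2 * c\<close>.\<close>
  then have "S \<le> c + S / 2"
    using t by (subst S_def, intro cSUP_least) auto
  then have "f t / w t \<le> 2 * c" using upper[OF t] by linarith
  then show ?thesis using w_pos[of t] by (simp add: pos_divide_le_eq w_def)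
qed

text \<open>Repayments only lower the balance, so with no debits the balance equation becomes the
  integral inequality of Gronwall type with \<open>c = debt H s\<close>.\<close>

lemma debt_growth_bound:
  assumes account: "loan_account H"
    and no_debits: "\<And>u. s \<le> u \<Longrightarrow> u \<le> t \<Longrightarrow> debits H u = debits H s"
    and rate: "\<And>u. s \<le> u \<Longrightarrow> u \<le> t \<Longrightarrow> interest_rate H u \<le> M"
    and "0 < M" "s \<le> t"
  shows "debt H t \<le> 2 * debt H s * exp (2 * M * (t - s))"
proof -
  define I where "I u = integral {s..u} (\<lambda>v. interest_rate H v * debt H v)" for u
  have debt: "0 \<le> debt H u" and rate_nonneg: "0 \<le> interest_rate H u" for u
    using account by (auto simp: loan_account_def)
  have balance: "((\<lambda>v. interest_rate H v * debt H v) has_integral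
      (debt H u - debt H s - (debits H u - debits H s) + (repaid H u - repaid H s))) {s..u}"
    if "s \<le> u" for u
    using account that by (auto simp: loan_account_def)
  have int: "((\<lambda>v. interest_rate H v * debt H v) has_integral I u) {s..u}" if "s \<le> u" for u
    unfolding I_def using balance[OF that] by (blast intro: integrable_integral)
  have grow: "debt H u \<le> debt H s + I u" if u: "s \<le> u" "u \<le> t" for u
  proof -
    have "mono (repaid H)" using account by (simp add: loan_account_def)
    then have "repaid H s \<le> repaid H u" using u by (simp add: monoD)
    moreover have "I u = debt H u - debt H s - (debits H u - debits H s) + (repaid H u - repaid H s)"
      using has_integral_unique[OF int balance] u by blast
    ultimately show ?thesis using no_debits[OF u] by linarith
  qed
  \<comment> \<open>The accrued interest is nonnegative, so \<open>I\<close> grows with its endpoint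
    and \<open>I t\<close> serves as one bound for the whole interval. This supplies the boundedness
    that the Gronwall estimate asks for.\<close>
  have "debt H u \<le> debt H s + I t" if u: "s \<le> u" "u \<le> t" for u
  proof -
    have "I u \<le> I t"
      using has_integral_subset_le[OF _ int int, of u t] u debt rate_nonneg by auto
    then show ?thesis using grow[OF u] by linarith
  qed
  then have "bdd_above (debt H ` {s..t})" by (intro bdd_aboveI2) auto
  then show ?thesis
    using assms debt int grow
    by (intro gronwall_integral_bound[where f = "debt H" and b = t and I = I and
          g = "\<lambda>v. interest_rate H v * debt H v"]) (auto intro: mult_right_mono)
qed

lemma debt_zero_after_extinction:
  assumes account: "loan_account H"
    and extinguished: "extinguished_at H \<sigma>"
    and no_debits: "debits H constant_on {\<sigma><..}"
    and "\<sigma> < t"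
  shows "debt H t = 0"
proof -
  obtain d where d: "\<And>u. \<sigma> < u \<Longrightarrow> debits H u = d"
    using no_debits by (auto simp: constant_on_def)
  \<comment> \<open>Bounding the rate all the way down to \<sigma> makes \<open>M\<close>
    independent of \<open>s\<close>, so the exponential factor stays bounded in the limit.\<close>
  have "bounded (interest_rate H ` {\<sigma>..t})" using account by (simp add: loan_account_def)
  then obtain M where "0 < M" and M: "\<And>u. u \<in> {\<sigma>..t} \<Longrightarrow> \<bar>interest_rate H u\<bar> \<le> M"
    by (auto simp: bounded_pos)
  have "debt H t \<le> 2 * debt H s * exp (2 * M * (t - s))" if "\<sigma> < s" "s < t" for s
  proof (rule debt_growth_bound[OF account])
    show "interest_rate H u \<le> M" if "s \<le> u" "u \<le> t" for u
      using M[of u] that \<open>\<sigma> < s\<close> by auto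
  qed (use that d \<open>0 < M\<close> in auto)
  then have "\<forall>\<^sub>F s in at_right \<sigma>. debt H t \<le> 2 * debt H s * exp (2 * M * (t - s))"
    using \<open>\<sigma> < t\<close> by (auto simp: eventually_at_right_field)
  moreover have "((\<lambda>s. 2 * debt H s * exp (2 * M * (t - s))) \<longlongrightarrow>
      2 * 0 * exp (2 * M * (t - \<sigma>))) (at_right \<sigma>)"
    using extinguished unfolding extinguished_at_def by (intro tendsto_intros)
  ultimately have "debt H t \<le> 2 * 0 * exp (2 * M * (t - \<sigma>))"
    by (intro tendsto_lowerbound) auto
  moreover have "0 \<le> debt H t" using account by (simp add: loan_account_def)
  ultimately show ?thesis by simp
qed

text \<open>The right limit at \<open>\<tau>r\<close> sees only times strictly after \<sigma>, even
  when both times coincide, and there the debt is zero. A nonnegative late recovery cannot turn this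
  into a loss.\<close>

lemma credit_loss_zero_after_extinction:
  assumes account: "loan_account H"
    and "extinguished_at H \<sigma>" "debits H constant_on {\<sigma><..}" "\<sigma> \<le> \<tau>r"
  shows "credit_loss H \<tau>r = 0"
proof -
  have "\<forall>\<^sub>F u in at_right \<tau>r. debt H u = 0"
    using eventually_at_right_less[of \<tau>r]
    by eventually_elim (use assms debt_zero_after_extinction in force)
  then have "(debt H \<longlongrightarrow> 0) (at_right \<tau>r)" by (rule tendsto_eventually)
  then have "Lim (at_right \<tau>r) (debt H) = 0" by (intro tendsto_Lim) auto
  then show ?thesis using account by (simp add: credit_loss_def loan_account_def)
qed

text \<open>Separate collateral makes \<open>redemption_charged\<close> vanish, which leaves only
  the three totals assumed constant.\<close>

lemma debits_constant_on:
  assumes "redemption_paid_from_separate_collateral H" "borrowed H constant_on A"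
    "delay_compensation H constant_on A" "redemption_guarantee H constant_on A"
  shows "debits H constant_on A"
proof -
  obtain p q r where "\<And>u. u \<in> A \<Longrightarrow> borrowed H u = p"
      "\<And>u. u \<in> A \<Longrightarrow> delay_compensation H u = q" "\<And>u. u \<in> A \<Longrightarrow> redemption_guarantee H u = r"
    using assms(2-4) unfolding constant_on_def by metis
  then have "debits H u = p + q + r" if "u \<in> A" for u
    using assms(1) that
    by (simp add: debits_def redemption_charged_def redemption_paid_from_separate_collateral_def)
  then show ?thesis by (auto simp: constant_on_def)
qed

theorem theorem6p5:
  fixes \<L> :: "real \<Rightarrow> real \<Rightarrow> loan_history"
    and \<sigma> \<tau>f \<tau>r \<Delta>f \<Delta>r :: real
  assumes account: "\<And>a b. \<sigma> \<le> a \<Longrightarrow> a \<le> b \<Longrightarrow> loan_account (\<L> a b)"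
    and separate: "\<And>a b. \<sigma> \<le> a \<Longrightarrow> a \<le> b \<Longrightarrow> redemption_paid_from_separate_collateral (\<L> a b)"
    and extinguished: "\<And>a b. \<sigma> \<le> a \<Longrightarrow> a \<le> b \<Longrightarrow> extinguished_at (\<L> a b) \<sigma>"
    and no_new_borrowing:
      "\<And>a b. \<sigma> \<le> a \<Longrightarrow> a \<le> b \<Longrightarrow> borrowed (\<L> a b) constant_on {\<sigma><..}"
    and no_delay_compensation:
      "\<And>a b. \<sigma> \<le> a \<Longrightarrow> a \<le> b \<Longrightarrow> delay_compensation (\<L> a b) constant_on {\<sigma><..}"
    and no_redemption_guarantee:
      "\<And>a b. \<sigma> \<le> a \<Longrightarrow> a \<le> b \<Longrightarrow> redemption_guarantee (\<L> a b) constant_on {\<sigma><..}"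
    and times: "\<sigma> \<le> \<tau>f" "\<tau>f \<le> \<tau>r"
    and delays: "\<Delta>f = \<tau>f - \<sigma>" "\<Delta>r = \<tau>r - \<tau>f"
  shows "((\<lambda>x. credit_loss_of_delays \<L> \<sigma> x \<Delta>r) has_real_derivative 0) (at \<Delta>f within {0..}) \<and>
         ((\<lambda>y. credit_loss_of_delays \<L> \<sigma> \<Delta>f y) has_real_derivative 0) (at \<Delta>r within {0..})"
proof -
  \<comment> \<open>Each pair of delays selects its own history, but all of them satisfy the
    hypotheses, so the loss vanishes on the whole closed quadrant.\<close>
  have zero: "credit_loss_of_delays \<L> \<sigma> x y = 0" if "0 \<le> x" "0 \<le> y" for x y
    unfolding credit_loss_of_delays_def
    using that
    by (intro credit_loss_zero_after_extinction[where \<sigma> = \<sigma>] debits_constant_on account separate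
        extinguished no_new_borrowing no_delay_compensation no_redemption_guarantee) auto
  \<comment> \<open>Delays are nonnegative, so the derivative is taken within \<open>{0..}\<close>
    and is one-sided at zero. The radius 1 is arbitrary, as \<open>h\<close> agrees with zero on all
    of \<open>{0..}\<close>.\<close>
  have deriv: "(h has_real_derivative 0) (at z within {0..})"
    if "\<And>x. 0 \<le> x \<Longrightarrow> h x = 0" "0 \<le> z" for h :: "real \<Rightarrow> real" and z
    by (rule has_field_derivative_transform_within[where f = "\<lambda>_. 0" and d = 1])
      (use that in auto)
  have "0 \<le> \<Delta>f" "0 \<le> \<Delta>r" using times delays by auto
  then show ?thesis using zero by (intro conjI deriv) auto
qed

end
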